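(* Let $\mathcal{C}$ be a category equipped with a compatible family of normal subgroups $\mathrm{Inn}(a)\trianglelefteq \mathrm{Aut}_{\mathcal{C}}(a)$, one for each object $a$ of $\mathcal{C}$ (the groups of inner automorphisms). Suppose that for each pair of objects $a,b$ the set $\mathrm{Hom}_{\mathcal{C}}(a,b)$ is endowed with a complete metric. Consider the following two axioms. (A1) For any three objects $a,b,c$, the composition map $\mathrm{Hom}_{\mathcal{C}}(a,b)\times \mathrm{Hom}_{\mathcal{C}}(b,c)\to \mathrm{Hom}_{\mathcal{C}}(a,c)$ is jointly continuous. (A2) For any two objects $a,b$ and any $k\in \mathrm{Inn}(b)$, the map $f\mapsto k\circ f$ is an isometry of $\mathrm{Hom}_{\mathcal{C}}(a,b)$ onto itself. Then: (i) If (A1) holds, let $\overline{\mathcal{C}^{\mathrm{out}}}$ be the structure with the same objects as $\mathcal{C}$, whose morphisms from $a$ to $b$ are the closures $\overline{[f]}$ in $\mathrm{Hom}_{\mathcal{C}}(a,b)$ of the equivalence classes $[f]$ modulo inner automorphisms of morphisms $f\colon a\to b$ in $\mathcal{C}$, and in which the product of a morphism $X$ from $a$ to $b$ and a morphism $Y$ from $b$ to $c$ is the closure in $\mathrm{Hom}_{\mathcal{C}}(a,c)$ of the set $\{g\circ f : f\in X,\ g\in Y\}$. Then the product of two such morphisms is again such a morphism (if $X=\overline{[f]}$ and $Y=\overline{[g]}$, the product is $\overline{[g\circ f]}$), $\overline{\mathcal{C}^{\mathrm{out}}}$ is a category, and the quotient map $\mathcal{C}\to\overline{\mathcal{C}^{\mathrm{out}}}$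 (identity on objects, $f\mapsto\overline{[f]}$ on morphisms) is a functor. (ii) If both (A1) and (A2) hold, then the quotient functor $\mathcal{C}\to\overline{\mathcal{C}^{\mathrm{out}}}$ is a classification functor, and in fact a strong classification functor.
   Context: Compatible family of normal subgroups: for every object $a$ of $\mathcal{C}$, $\mathrm{Inn}(a)$ is a normal subgroup of $\mathrm{Aut}_{\mathcal{C}}(a)$, and for every morphism $f\colon a\to b$ of $\mathcal{C}$ and every $h\in\mathrm{Inn}(a)$ there exists $k\in\mathrm{Inn}(b)$ with $f\circ h=k\circ f$. Equivalence modulo inner automorphisms: morphisms $f,g\colon a\to b$ are equivalent if $g=k\circ f\circ h$ for some $h\in\mathrm{Inn}(a)$ and $k\in\mathrm{Inn}(b)$; $[f]\subseteq\mathrm{Hom}_{\mathcal{C}}(a,b)$ denotes the equivalence class of $f$. Closures are taken in the metric topology of the relevant set of morphisms. A functor $F\colon\mathcal{C}\to\mathcal{D}$ is a classification functor if it distinguishes isomorphism classes: for all objects $a,b$ of $\mathcal{C}$, if $F(a)\cong F(b)$ in $\mathcal{D}$ then $a\cong b$ in $\mathcal{C}$. It is a strong classification functor if isomorphisms lift: for all objects $a,b$ of $\mathcal{C}$, every isomorphism $F(a)\to F(b)$ in $\mathcal{D}$ is of the form $F(\varphi)$ for some isomorphism $\varphi\colon a\to b$ in $\mathcal{C}$. *)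

theory Defs
  imports "HOL-Analysis.Analysis" "HOL-Algebra.Coset"
begin

text \<open>Hom-sets are indexed by source and target and need not be disjoint, so composition is indexed
  by objects as well: \<open>Cmp C a b c g f\<close> is the composite of \<open>f\<close> from \<open>a\<close> to \<open>b\<close> followed by \<open>g\<close>
  from \<open>b\<close> to \<open>c\<close>. Values outside the hom-sets are irrelevant.\<close>

record ('o, 'm) cat =
  Ob :: "'o set"
  Mor :: "'o \<Rightarrow> 'o \<Rightarrow> 'm set"
  Idn :: "'o \<Rightarrow> 'm"
  Cmp :: "'o \<Rightarrow> 'o \<Rightarrow> 'o \<Rightarrow> 'm \<Rightarrow> 'm \<Rightarrow> 'm"

locale category =
  fixes C :: "('o, 'm) cat"
  assumes idn_closed: "a \<in> Ob C \<Longrightarrow> Idn C a \<in> Mor C a a"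
    and cmp_closed: "\<lbrakk>a \<in> Ob C; b \<in> Ob C; c \<in> Ob C; f \<in> Mor C a b; g \<in> Mor C b c\<rbrakk>
      \<Longrightarrow> Cmp C a b c g f \<in> Mor C a c"
    and cmp_idn_right: "\<lbrakk>a \<in> Ob C; b \<in> Ob C; f \<in> Mor C a b\<rbrakk> \<Longrightarrow> Cmp C a a b f (Idn C a) = f"
    and cmp_idn_left: "\<lbrakk>a \<in> Ob C; b \<in> Ob C; f \<in> Mor C a b\<rbrakk> \<Longrightarrow> Cmp C a b b (Idn C b) f = f"
    and cmp_assoc: "\<lbrakk>a \<in> Ob C; b \<in> Ob C; c \<in> Ob C; e \<in> Ob C;
        f \<in> Mor C a b; g \<in> Mor C b c; h \<in> Mor C c e\<rbrakk>
      \<Longrightarrow> Cmp C a c e h (Cmp C a b c g f) = Cmp C a b e (Cmp C b c e h g) f"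

definition is_iso :: "('o, 'm) cat \<Rightarrow> 'o \<Rightarrow> 'o \<Rightarrow> 'm \<Rightarrow> bool" where
  "is_iso C a b f \<longleftrightarrow> f \<in> Mor C a b \<and>
    (\<exists>g \<in> Mor C b a. Cmp C a b a g f = Idn C a \<and> Cmp C b a b f g = Idn C b)"

definition isomorphic :: "('o, 'm) cat \<Rightarrow> 'o \<Rightarrow> 'o \<Rightarrow> bool" where
  "isomorphic C a b \<longleftrightarrow> (\<exists>f. is_iso C a b f)"

definition Aut :: "('o, 'm) cat \<Rightarrow> 'o \<Rightarrow> 'm monoid" where
  "Aut C a = \<lparr>carrier = {f. is_iso C a a f}, mult = Cmp C a a a, one = Idn C a\<rparr>"

locale functor_between = C: category C + D: category D
  for C :: "('o, 'm) cat" and D :: "('p, 'n) cat" +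
  fixes Fo :: "'o \<Rightarrow> 'p" and Fm :: "'o \<Rightarrow> 'o \<Rightarrow> 'm \<Rightarrow> 'n"
  assumes ob_closed: "a \<in> Ob C \<Longrightarrow> Fo a \<in> Ob D"
    and mor_closed: "\<lbrakk>a \<in> Ob C; b \<in> Ob C; f \<in> Mor C a b\<rbrakk> \<Longrightarrow> Fm a b f \<in> Mor D (Fo a) (Fo b)"
    and map_idn: "a \<in> Ob C \<Longrightarrow> Fm a a (Idn C a) = Idn D (Fo a)"
    and map_cmp: "\<lbrakk>a \<in> Ob C; b \<in> Ob C; c \<in> Ob C; f \<in> Mor C a b; g \<in> Mor C b c\<rbrakk>
      \<Longrightarrow> Fm a c (Cmp C a b c g f) = Cmp D (Fo a) (Fo b) (Fo c) (Fm b c g) (Fm a b f)"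

locale classification_functor = functor_between +
  assumes isomorphic_reflect:
    "\<lbrakk>a \<in> Ob C; b \<in> Ob C; isomorphic D (Fo a) (Fo b)\<rbrakk> \<Longrightarrow> isomorphic C a b"

locale strong_classification_functor = functor_between +
  assumes iso_lift:
    "\<lbrakk>a \<in> Ob C; b \<in> Ob C; is_iso D (Fo a) (Fo b) \<psi>\<rbrakk> \<Longrightarrow> \<exists>\<phi>. is_iso C a b \<phi> \<and> Fm a b \<phi> = \<psi>"

locale category_with_inner = category C for C :: "('o, 'm) cat" +
  fixes Inn :: "'o \<Rightarrow> 'm set"
  assumes inn_normal: "a \<in> Ob C \<Longrightarrow> Inn a \<lhd> Aut C a"
    and inn_compatible: "\<lbrakk>a \<in> Ob C; b \<in> Ob C; f \<in> Mor C a b; h \<in> Inn a\<rbrakk>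
      \<Longrightarrow> \<exists>k \<in> Inn b. Cmp C a a b f h = Cmp C a b b k f"

locale metric_category_with_inner = category_with_inner +
  fixes m :: "'a \<Rightarrow> 'a \<Rightarrow> 'b metric"
  assumes mspace_mor: "\<lbrakk>a \<in> Ob C; b \<in> Ob C\<rbrakk> \<Longrightarrow> mspace (m a b) = Mor C a b"
    and complete_mor: "\<lbrakk>a \<in> Ob C; b \<in> Ob C\<rbrakk> \<Longrightarrow> mcomplete_of (m a b)"

definition axiom_A1 :: "('o, 'm) cat \<Rightarrow> ('o \<Rightarrow> 'o \<Rightarrow> 'm metric) \<Rightarrow> bool" where
  "axiom_A1 C m \<longleftrightarrow> (\<forall>a \<in> Ob C. \<forall>b \<in> Ob C. \<forall>c \<in> Ob C.
    continuous_map (prod_topology (mtopology_of (m a b)) (mtopology_of (m b c)))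
      (mtopology_of (m a c)) (\<lambda>(f, g). Cmp C a b c g f))"

definition axiom_A2 ::
    "('o, 'm) cat \<Rightarrow> ('o \<Rightarrow> 'm set) \<Rightarrow> ('o \<Rightarrow> 'o \<Rightarrow> 'm metric) \<Rightarrow> bool" where
  "axiom_A2 C Inn m \<longleftrightarrow> (\<forall>a \<in> Ob C. \<forall>b \<in> Ob C. \<forall>k \<in> Inn b.
    Cmp C a b b k ` Mor C a b = Mor C a b \<and>
    (\<forall>f \<in> Mor C a b. \<forall>g \<in> Mor C a b.
      mdist (m a b) (Cmp C a b b k f) (Cmp C a b b k g) = mdist (m a b) f g))"

definition inn_class :: "('o, 'm) cat \<Rightarrow> ('o \<Rightarrow> 'm set) \<Rightarrow> 'o \<Rightarrow> 'o \<Rightarrow> 'm \<Rightarrow> 'm set" where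
  "inn_class C Inn a b f =
    {g \<in> Mor C a b. \<exists>h \<in> Inn a. \<exists>k \<in> Inn b. g = Cmp C a b b k (Cmp C a a b f h)}"

definition closed_class ::
    "('o, 'm) cat \<Rightarrow> ('o \<Rightarrow> 'm set) \<Rightarrow> ('o \<Rightarrow> 'o \<Rightarrow> 'm metric) \<Rightarrow> 'o \<Rightarrow> 'o \<Rightarrow> 'm \<Rightarrow> 'm set" where
  "closed_class C Inn m a b f = mtopology_of (m a b) closure_of inn_class C Inn a b f"

text \<open>The product determines the identities, so choosing the classes of the identities of \<open>C\<close> as
  \<open>Idn\<close> adds no data.\<close>

definition Cout ::
    "('o, 'm) cat \<Rightarrow> ('o \<Rightarrow> 'm set) \<Rightarrow> ('o \<Rightarrow> 'o \<Rightarrow> 'm metric) \<Rightarrow> ('o, 'm set) cat" where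
  "Cout C Inn m =
    \<lparr>Ob = Ob C,
     Mor = \<lambda>a b. closed_class C Inn m a b ` Mor C a b,
     Idn = \<lambda>a. closed_class C Inn m a a (Idn C a),
     Cmp = \<lambda>a b c Y X. mtopology_of (m a c) closure_of {Cmp C a b c g f | f g. f \<in> X \<and> g \<in> Y}\<rparr>"

end

theory Submission
  imports Defs
begin

text \<open>By compatibility every class modulo inner automorphisms is a left orbit
  \<open>{k \<circ> f | k \<in> Inn b}\<close>, and orbits multiply. For part (ii) an isomorphism of closed classes
  \<open>[f]\<close>, \<open>[g]\<close> is lifted by Elliott's approximate intertwining: one corrects \<open>f\<close> and \<open>g\<close> alternately
  by inner automorphisms so that the composites \<open>g\<^sub>n \<circ> f\<^sub>n\<close> and \<open>f\<^sub>n\<^sub>+\<^sub>1 \<circ> g\<^sub>n\<close> approach the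
  identities. The next correction \<open>k \<circ> f\<close> is unknown when \<open>g\<^sub>n\<close> is chosen, but by (A2) left
  composition with \<open>k \<circ> f\<close> has the same modulus of continuity as left composition with \<open>f\<close>, so
  the sequences can be made Cauchy, and their limits are mutually inverse.\<close>

section \<open>Sequences, closures and geometric convergence in a metric space\<close>

lemma closure_of_sequence:
  assumes "x \<in> mtopology_of M closure_of S"
  obtains \<sigma> :: "nat \<Rightarrow> 'a" where "\<And>n. \<sigma> n \<in> S" "limitin (mtopology_of M) \<sigma> x sequentially"
proof -
  interpret Metric_space "mspace M" "mdist M" by simp
  have x: "x \<in> mspace M" and near: "\<And>r. r > 0 \<Longrightarrow> \<exists>y \<in> S. y \<in> mball x r"
    using assms by (auto simp: mtopology_of_def metric_closure_of)
  have "\<forall>n. \<exists>y. y \<in> S \<and> y \<in> mball x (inverse (Suc n))"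
    using near by (metis of_nat_0_less_iff positive_imp_inverse_positive zero_less_Suc)
  then obtain \<sigma> where \<sigma>: "\<And>n::nat. \<sigma> n \<in> S \<and> \<sigma> n \<in> mball x (inverse (Suc n))"
    by metis
  have "(\<lambda>n. mdist M (\<sigma> n) x) \<longlonglongrightarrow> 0"
  proof (rule tendsto_sandwich[OF _ _ tendsto_const LIMSEQ_inverse_real_of_nat])
    show "\<forall>\<^sub>F n in sequentially. mdist M (\<sigma> n) x \<le> inverse (Suc n)"
      using \<sigma> by (auto simp: commute less_imp_le)
  qed simp
  then have "limitin (mtopology_of M) \<sigma> x sequentially"
    using \<sigma> x by (auto simp: mtopology_of_def limitin_metric_dist_null)
  with \<sigma> that show ?thesis by blast
qed

lemma limitin_imp_in_closure_of:
  assumes "limitin (mtopology_of M) \<sigma> x sequentially" "\<And>n::nat. \<sigma> n \<in> S"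
  shows "x \<in> mtopology_of M closure_of S"
proof -
  interpret Metric_space "mspace M" "mdist M" by simp
  have "\<exists>y \<in> S. y \<in> mball x r" if "r > 0" for r
    using assms that unfolding mtopology_of_def limit_metric_sequentially
    by (metis commute in_mball order_refl)
  then show ?thesis
    using assms(1) by (auto simp: mtopology_of_def metric_closure_of limitin_metric)
qed

text \<open>The steps are dominated by a geometric series, so the sequence is Cauchy and
  completeness supplies a limit. Nonnegativity of \<open>c\<close> comes from the step at index
  0.\<close>

lemma geometric_imp_convergent:
  assumes "mcomplete_of M" and mem: "\<And>n. \<sigma> n \<in> mspace M"
    and step: "\<And>n. mdist M (\<sigma> n) (\<sigma> (Suc n)) \<le> c * (1/2) ^ n"
  shows "\<exists>x. limitin (mtopology_of M) \<sigma> x sequentially"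
proof -
  interpret Metric_space "mspace M" "mdist M" by simp
  have "mdist M (\<sigma> 0) (\<sigma> (Suc 0)) \<le> c"
    using step[of 0] by simp
  then have c: "c \<ge> 0"
    using nonneg order_trans by blast
  \<comment> \<open>The bound is the exact partial sum of the geometric series rather than its
    total, so that the induction on \<open>k\<close> closes: each step adds precisely
    \<open>c * (1/2) ^ (n + k)\<close>.\<close>
  have tail: "mdist M (\<sigma> n) (\<sigma> (n + k)) \<le> 2 * c * ((1/2) ^ n - (1/2) ^ (n + k))" for n k
  proof (induction k)
    case 0
    then show ?case using mem by simp
  next
    case (Suc k)
    have "mdist M (\<sigma> n) (\<sigma> (n + Suc k)) \<le> mdist M (\<sigma> n) (\<sigma> (n + k)) + c * (1/2) ^ (n + k)"
      using triangle[OF mem mem mem, of n "n + Suc k" "n + k"] step[of "n + k"] by simp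
    with Suc show ?case by (simp add: algebra_simps)
  qed
  have tail': "mdist M (\<sigma> n) (\<sigma> n') \<le> 2 * c * (1/2) ^ N" if "N \<le> n" "n \<le> n'" for N n n'
  proof -
    have "mdist M (\<sigma> n) (\<sigma> n') \<le> 2 * c * ((1/2) ^ n - (1/2) ^ n')"
      using tail[of n "n' - n"] that by simp
    also have "\<dots> \<le> 2 * c * (1/2) ^ N"
      using c that by (intro mult_left_mono) (auto intro: order_trans[of _ "(1/2) ^ n"] power_decreasing)
    finally show ?thesis .
  qed
  have "MCauchy \<sigma>"
    unfolding MCauchy_def
  proof (intro conjI strip)
    fix \<epsilon> :: real
    assume "\<epsilon> > 0"
    have "(\<lambda>n. 2 * c * (1/2) ^ n) \<longlonglongrightarrow> 2 * c * 0"
      by (intro tendsto_intros) simp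
    then have "\<forall>\<^sub>F n in sequentially. 2 * c * (1/2) ^ n < \<epsilon>"
      using \<open>\<epsilon> > 0\<close> by (intro order_tendstoD) auto
    then obtain N where N: "2 * c * (1/2) ^ N < \<epsilon>"
      by (auto simp: eventually_sequentially)
    have "mdist M (\<sigma> n) (\<sigma> n') < \<epsilon>" if "N \<le> n" "N \<le> n'" for n n'
      using tail'[of N n n'] tail'[of N n' n] N that commute[of "\<sigma> n" "\<sigma> n'"]
      by (cases "n \<le> n'") auto
    then show "\<exists>N. \<forall>n n'. N \<le> n \<longrightarrow> N \<le> n' \<longrightarrow> mdist M (\<sigma> n) (\<sigma> n') < \<epsilon>"
      by blast
  qed (use mem in blast)
  then show ?thesis
    using assms(1) by (simp add: mcomplete_of_def mcomplete_def mtopology_of_def)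
qed

section \<open>Algebra of the classes modulo inner automorphisms\<close>

context category_with_inner
begin

lemma inn_iso: "\<lbrakk>a \<in> Ob C; k \<in> Inn a\<rbrakk> \<Longrightarrow> is_iso C a a k"
  using normal_imp_subgroup[OF inn_normal, THEN subgroup.subset] by (auto simp: Aut_def)

lemma inn_mor: "\<lbrakk>a \<in> Ob C; k \<in> Inn a\<rbrakk> \<Longrightarrow> k \<in> Mor C a a"
  using inn_iso by (simp add: is_iso_def)

lemma inn_idn: "a \<in> Ob C \<Longrightarrow> Idn C a \<in> Inn a"
  using normal_imp_subgroup[OF inn_normal, THEN subgroup.one_closed] by (simp add: Aut_def)

lemma inn_cmp: "\<lbrakk>a \<in> Ob C; h \<in> Inn a; k \<in> Inn a\<rbrakk> \<Longrightarrow> Cmp C a a a h k \<in> Inn a"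
  using normal_imp_subgroup[OF inn_normal, THEN subgroup.m_closed, of a h k] by (simp add: Aut_def)

lemma inn_inverse:
  assumes "a \<in> Ob C" "k \<in> Inn a"
  obtains k' where "k' \<in> Inn a" "Cmp C a a a k' k = Idn C a"
proof -
  interpret normal "Inn a" "Aut C a" using inn_normal assms(1) .
  from assms(2) have "inv\<^bsub>Aut C a\<^esub> k \<in> Inn a" "inv\<^bsub>Aut C a\<^esub> k \<otimes>\<^bsub>Aut C a\<^esub> k = \<one>\<^bsub>Aut C a\<^esub>"
    by (auto intro: l_inv mem_carrier)
  with that show ?thesis by (simp add: Aut_def)
qed

text \<open>Compatibility moves the right factor \<open>h\<close> across \<open>f\<close>, where it
  merges with the left factor; conversely the identity may serve as \<open>h\<close>. Afterwards
  only left multiplication by \<open>Inn b\<close> has to be handled.\<close>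

lemma inn_class_eq:
  assumes ab: "a \<in> Ob C" "b \<in> Ob C" and f: "f \<in> Mor C a b"
  shows "inn_class C Inn a b f = (\<lambda>k. Cmp C a b b k f) ` Inn b"
proof (intro equalityI subsetI)
  fix g assume "g \<in> inn_class C Inn a b f"
  then obtain h k where h: "h \<in> Inn a" and k: "k \<in> Inn b" and g: "g = Cmp C a b b k (Cmp C a a b f h)"
    by (auto simp: inn_class_def)
  obtain k' where k': "k' \<in> Inn b" "Cmp C a a b f h = Cmp C a b b k' f"
    using inn_compatible[OF ab f h] by blast
  have "g = Cmp C a b b (Cmp C b b b k k') f"
    using g k k' ab f by (simp add: cmp_assoc inn_mor)
  then show "g \<in> (\<lambda>k. Cmp C a b b k f) ` Inn b"
    using inn_cmp ab k k' by blast
next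
  fix g assume "g \<in> (\<lambda>k. Cmp C a b b k f) ` Inn b"
  then obtain k where k: "k \<in> Inn b" "g = Cmp C a b b k f"
    by blast
  then have "g = Cmp C a b b k (Cmp C a a b f (Idn C a))"
    using ab f by (simp add: cmp_idn_right)
  moreover have "g \<in> Mor C a b"
    using k ab f by (simp add: cmp_closed inn_mor)
  ultimately show "g \<in> inn_class C Inn a b f"
    using k(1) inn_idn[OF ab(1)] unfolding inn_class_def by blast
qed

lemma inn_class_subset: "inn_class C Inn a b f \<subseteq> Mor C a b"
  by (auto simp: inn_class_def)

lemma inn_class_self:
  assumes "a \<in> Ob C" "b \<in> Ob C" "f \<in> Mor C a b"
  shows "f \<in> inn_class C Inn a b f"
  using assms inn_idn[of b] cmp_idn_left by (force simp: inn_class_eq)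

lemma inn_class_sym:
  assumes "a \<in> Ob C" "b \<in> Ob C" "f \<in> Mor C a b" "g \<in> inn_class C Inn a b f"
  shows "f \<in> inn_class C Inn a b g"
proof -
  obtain k where k: "k \<in> Inn b" "g = Cmp C a b b k f"
    using assms by (auto simp: inn_class_eq)
  obtain k' where k': "k' \<in> Inn b" "Cmp C b b b k' k = Idn C b"
    using inn_inverse assms k by blast
  have "Cmp C a b b k' g = f"
    using assms k k' by (simp add: cmp_assoc inn_mor cmp_idn_left)
  moreover have "g \<in> Mor C a b"
    using assms(4) inn_class_subset by blast
  ultimately show ?thesis
    using assms k' by (force simp: inn_class_eq)
qed

text \<open>The inner automorphism in the middle, between \<open>f\<close> and \<open>g\<close>, is
  pushed through \<open>g\<close> by compatibility and joins the one at the target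
  \<open>c\<close>.\<close>

lemma inn_class_cmp:
  assumes abc: "a \<in> Ob C" "b \<in> Ob C" "c \<in> Ob C" and f: "f \<in> Mor C a b" and g: "g \<in> Mor C b c"
    and f': "f' \<in> inn_class C Inn a b f" and g': "g' \<in> inn_class C Inn b c g"
  shows "Cmp C a b c g' f' \<in> inn_class C Inn a c (Cmp C a b c g f)"
proof -
  obtain k l where k: "k \<in> Inn b" "f' = Cmp C a b b k f" and l: "l \<in> Inn c" "g' = Cmp C b c c l g"
    using assms by (auto simp: inn_class_eq)
  obtain l' where l': "l' \<in> Inn c" "Cmp C b b c g k = Cmp C b c c l' g"
    using inn_compatible abc g k by blast
  note mor = inn_mor[OF abc(2) k(1)] inn_mor[OF abc(3) l(1)] inn_mor[OF abc(3) l'(1)]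
  have "Cmp C a b c g' f' = Cmp C a c c l (Cmp C a b c g (Cmp C a b b k f))"
    using k l abc f g mor by (simp add: cmp_assoc[symmetric] cmp_closed)
  also have "Cmp C a b c g (Cmp C a b b k f) = Cmp C a c c l' (Cmp C a b c g f)"
    using l' abc f g mor by (simp add: cmp_assoc)
  also have "Cmp C a c c l (Cmp C a c c l' (Cmp C a b c g f)) =
      Cmp C a c c (Cmp C c c c l l') (Cmp C a b c g f)"
    using abc f g mor by (simp add: cmp_assoc[where f = "Cmp C a b c g f"] cmp_closed)
  finally show ?thesis
    using abc f g inn_cmp[OF abc(3) l(1) l'(1)] by (auto simp: inn_class_eq cmp_closed)
qed

text \<open>By associativity, an inner correction of a composite can be absorbed entirely into the
  second factor while \<open>f\<close> stays fixed. This shows that the class of a composite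
  consists of products, and in the intertwining it turns a correction of \<open>g \<circ> u\<close>
  into a correction of \<open>g\<close>.\<close>

lemma inn_class_cmp_left:
  assumes abc: "a \<in> Ob C" "b \<in> Ob C" "c \<in> Ob C" and f: "f \<in> Mor C a b" and g: "g \<in> Mor C b c"
    and x: "x \<in> inn_class C Inn a c (Cmp C a b c g f)"
  obtains g' where "g' \<in> inn_class C Inn b c g" "x = Cmp C a b c g' f"
proof -
  obtain k where "k \<in> Inn c" "x = Cmp C a c c k (Cmp C a b c g f)"
    using assms by (auto simp: inn_class_eq cmp_closed)
  then have "Cmp C b c c k g \<in> inn_class C Inn b c g" "x = Cmp C a b c (Cmp C b c c k g) f"
    using abc f g by (auto simp: inn_class_eq cmp_assoc inn_mor)
  with that show ?thesis by blast
qed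

end

section \<open>Closed classes inside the metric hom-sets\<close>

context metric_category_with_inner
begin

lemma limitin_mor:
  assumes "a \<in> Ob C" "b \<in> Ob C" "limitin (mtopology_of (m a b)) \<sigma> f F"
  shows "f \<in> Mor C a b"
  using limitin_topspace[OF assms(3)] assms by (simp add: mspace_mor)

lemma limitin_const_mor:
  "\<lbrakk>a \<in> Ob C; b \<in> Ob C; f \<in> Mor C a b\<rbrakk> \<Longrightarrow> limitin (mtopology_of (m a b)) (\<lambda>_. f) f F"
  by (simp add: mspace_mor)

lemma inn_class_subset_closed_class:
  assumes "a \<in> Ob C" "b \<in> Ob C"
  shows "inn_class C Inn a b f \<subseteq> closed_class C Inn m a b f"
  unfolding closed_class_def
  by (rule closure_of_subset) (simp add: assms mspace_mor inn_class_subset)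

lemma closed_class_self:
  "\<lbrakk>a \<in> Ob C; b \<in> Ob C; f \<in> Mor C a b\<rbrakk> \<Longrightarrow> f \<in> closed_class C Inn m a b f"
  using inn_class_self inn_class_subset_closed_class by blast

lemma closed_class_subset:
  assumes "a \<in> Ob C" "b \<in> Ob C"
  shows "closed_class C Inn m a b f \<subseteq> Mor C a b"
  using closure_of_subset_topspace[of "mtopology_of (m a b)"] assms
  by (simp add: closed_class_def mspace_mor)

lemma Ob_Cout: "Ob (Cout C Inn m) = Ob C"
  and Mor_Cout: "Mor (Cout C Inn m) a b = closed_class C Inn m a b ` Mor C a b"
  and Idn_Cout: "Idn (Cout C Inn m) a = closed_class C Inn m a a (Idn C a)"
  by (simp_all add: Cout_def)

end

section \<open>Continuous composition: the category of closed classes and the quotient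
  functor\<close>

locale A1_category = metric_category_with_inner +
  assumes A1: "axiom_A1 C m"
begin

lemma limitin_cmp:
  assumes abc: "a \<in> Ob C" "b \<in> Ob C" "c \<in> Ob C"
    and "limitin (mtopology_of (m a b)) \<sigma> f F" "limitin (mtopology_of (m b c)) \<tau> g F"
  shows "limitin (mtopology_of (m a c)) (\<lambda>n. Cmp C a b c (\<tau> n) (\<sigma> n)) (Cmp C a b c g f) F"
proof -
  have "limitin (prod_topology (mtopology_of (m a b)) (mtopology_of (m b c)))
      (\<lambda>n. (\<sigma> n, \<tau> n)) (f, g) F"
    using assms by (simp add: limitin_pairwise o_def)
  moreover have "continuous_map (prod_topology (mtopology_of (m a b)) (mtopology_of (m b c)))
      (mtopology_of (m a c)) (\<lambda>(f, g). Cmp C a b c g f)"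
    using A1 abc unfolding axiom_A1_def by blast
  ultimately show ?thesis
    using continuous_map_limit by (fastforce simp: o_def)
qed

text \<open>One inclusion holds because, by joint continuity, a product of limits of
  \<open>f\<close>-corrections and \<open>g\<close>-corrections is a limit of corrections of the
  composite. For the other, every correction of the composite is already a product of a correction
  of \<open>g\<close> with \<open>f\<close> itself.\<close>

lemma closed_class_cmp:
  assumes abc: "a \<in> Ob C" "b \<in> Ob C" "c \<in> Ob C" and f: "f \<in> Mor C a b" and g: "g \<in> Mor C b c"
  shows "Cmp (Cout C Inn m) a b c (closed_class C Inn m b c g) (closed_class C Inn m a b f) =
    closed_class C Inn m a c (Cmp C a b c g f)"
proof -
  let ?P = "{Cmp C a b c g' f' | f' g'.
    f' \<in> closed_class C Inn m a b f \<and> g' \<in> closed_class C Inn m b c g}"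
  have "Cmp C a b c g' f' \<in> closed_class C Inn m a c (Cmp C a b c g f)"
    if f': "f' \<in> closed_class C Inn m a b f" and g': "g' \<in> closed_class C Inn m b c g" for f' g'
  proof -
    obtain \<sigma> where \<sigma>: "\<And>n. \<sigma> n \<in> inn_class C Inn a b f" "limitin (mtopology_of (m a b)) \<sigma> f' sequentially"
      using f' closure_of_sequence unfolding closed_class_def by metis
    obtain \<tau> where \<tau>: "\<And>n. \<tau> n \<in> inn_class C Inn b c g" "limitin (mtopology_of (m b c)) \<tau> g' sequentially"
      using g' closure_of_sequence unfolding closed_class_def by metis
    show ?thesis
      unfolding closed_class_def
      by (rule limitin_imp_in_closure_of[OF limitin_cmp[OF abc \<sigma>(2) \<tau>(2)]])
        (rule inn_class_cmp[OF abc f g \<sigma>(1) \<tau>(1)])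
  qed
  then have "mtopology_of (m a c) closure_of ?P \<subseteq> closed_class C Inn m a c (Cmp C a b c g f)"
    unfolding closed_class_def by (intro closure_of_minimal) auto
  moreover have "inn_class C Inn a c (Cmp C a b c g f) \<subseteq> ?P"
  proof
    fix x assume "x \<in> inn_class C Inn a c (Cmp C a b c g f)"
    then obtain g' where g': "g' \<in> inn_class C Inn b c g" "x = Cmp C a b c g' f"
      using inn_class_cmp_left[OF abc f g] by blast
    then have "g' \<in> closed_class C Inn m b c g"
      using inn_class_subset_closed_class abc by blast
    with g' show "x \<in> ?P"
      using closed_class_self abc f by blast
  qed
  then have "closed_class C Inn m a c (Cmp C a b c g f) \<subseteq> mtopology_of (m a c) closure_of ?P"
    unfolding closed_class_def by (rule closure_of_mono)
  ultimately show ?thesis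
    by (simp add: Cout_def)
qed

text \<open>Every morphism is the closed class of a representative and
  \<open>closed_class_cmp\<close> computes products on representatives, so all axioms descend from
  \<open>C\<close>.\<close>

lemma category_Cout: "category (Cout C Inn m)"
  by unfold_locales
    (auto simp: Ob_Cout Mor_Cout Idn_Cout closed_class_cmp idn_closed cmp_closed
      cmp_idn_left cmp_idn_right cmp_assoc)

lemma functor_Cout: "functor_between C (Cout C Inn m) (\<lambda>a. a) (closed_class C Inn m)"
proof -
  interpret D: category "Cout C Inn m" by (rule category_Cout)
  show ?thesis
    by unfold_locales (auto simp: Ob_Cout Mor_Cout Idn_Cout closed_class_cmp)
qed

end

section \<open>Inner automorphisms as isometries: closed classes partition the hom-sets\<close>

locale A1_A2_category = A1_category +
  assumes A2: "axiom_A2 C Inn m"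
begin

lemma inn_isometry:
  assumes "a \<in> Ob C" "b \<in> Ob C" "k \<in> Inn b" "f \<in> Mor C a b" "g \<in> Mor C a b"
  shows "mdist (m a b) (Cmp C a b b k f) (Cmp C a b b k g) = mdist (m a b) f g"
  using A2 assms unfolding axiom_A2_def by blast

text \<open>Left composition with an inner automorphism is continuous and preserves the orbit of
  \<open>f\<close>, hence also its closure. So the whole orbit of a limit point \<open>g\<close>
  remains in that closure.\<close>

lemma closed_class_mono:
  assumes ab: "a \<in> Ob C" "b \<in> Ob C" and f: "f \<in> Mor C a b" and g: "g \<in> closed_class C Inn m a b f"
  shows "closed_class C Inn m a b g \<subseteq> closed_class C Inn m a b f"
proof -
  have gm: "g \<in> Mor C a b"
    using closed_class_subset ab g by blast
  have "Cmp C a b b k g \<in> closed_class C Inn m a b f" if k: "k \<in> Inn b" for k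
  proof -
    obtain \<sigma> where \<sigma>: "\<And>n. \<sigma> n \<in> inn_class C Inn a b f" "limitin (mtopology_of (m a b)) \<sigma> g sequentially"
      using g closure_of_sequence unfolding closed_class_def by metis
    have "limitin (mtopology_of (m a b)) (\<lambda>n. Cmp C a b b k (\<sigma> n)) (Cmp C a b b k g) sequentially"
      using k ab \<sigma> by (intro limitin_cmp limitin_const_mor) (auto intro: inn_mor)
    moreover have "Cmp C a b b k (\<sigma> n) \<in> inn_class C Inn a b f" for n
    proof -
      obtain l where l: "l \<in> Inn b" "\<sigma> n = Cmp C a b b l f"
        using \<sigma>(1)[of n] ab f by (auto simp: inn_class_eq)
      then have "Cmp C a b b k (\<sigma> n) = Cmp C a b b (Cmp C b b b k l) f"
        using k ab f by (simp add: cmp_assoc inn_mor)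
      then show ?thesis
        using l k ab f inn_cmp by (auto simp: inn_class_eq)
    qed
    ultimately show ?thesis
      unfolding closed_class_def by (rule limitin_imp_in_closure_of)
  qed
  then have "inn_class C Inn a b g \<subseteq> closed_class C Inn m a b f"
    using ab gm by (auto simp: inn_class_eq)
  then show ?thesis
    unfolding closed_class_def by (intro closure_of_minimal) auto
qed

text \<open>If \<open>k \<circ> f\<close> lies within \<open>r\<close> of \<open>g\<close>, applying
  the inverse of \<open>k\<close>, which is an isometry by (A2), shows that \<open>f\<close> lies
  within \<open>r\<close> of a correction of \<open>g\<close>.\<close>

lemma closed_class_sym:
  assumes ab: "a \<in> Ob C" "b \<in> Ob C" and f: "f \<in> Mor C a b" and g: "g \<in> closed_class C Inn m a b f"
  shows "f \<in> closed_class C Inn m a b g"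
proof -
  have gm: "g \<in> Mor C a b"
    using closed_class_subset ab g by blast
  interpret M: Metric_space "mspace (m a b)" "mdist (m a b)" by simp
  have "\<exists>y \<in> inn_class C Inn a b g. y \<in> M.mball f r" if "r > 0" for r
  proof -
    obtain x where x: "x \<in> inn_class C Inn a b f" "mdist (m a b) g x < r"
      using g \<open>r > 0\<close> unfolding closed_class_def mtopology_of_def M.metric_closure_of by auto
    then obtain k where k: "k \<in> Inn b" "x = Cmp C a b b k f"
      using ab f by (auto simp: inn_class_eq)
    obtain k' where k': "k' \<in> Inn b" "Cmp C b b b k' k = Idn C b"
      using inn_inverse ab k by blast
    have xm: "x \<in> Mor C a b" using x inn_class_subset by blast
    have "Cmp C a b b k' x = f"
      using ab f k k' by (simp add: cmp_assoc inn_mor cmp_idn_left)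
    then have "mdist (m a b) f (Cmp C a b b k' g) < r"
      using inn_isometry[OF ab k'(1) xm gm] x(2) by (simp add: mdist_commute)
    moreover have "Cmp C a b b k' g \<in> inn_class C Inn a b g"
      using ab gm k' by (auto simp: inn_class_eq)
    moreover have "Cmp C a b b k' g \<in> Mor C a b"
      using ab gm k' by (auto intro: cmp_closed inn_mor)
    ultimately show ?thesis
      unfolding M.in_mball using ab f by (auto simp: mspace_mor)
  qed
  then show ?thesis
    using ab f unfolding closed_class_def mtopology_of_def M.metric_closure_of by (auto simp: mspace_mor)
qed

lemma closed_class_eq:
  assumes "a \<in> Ob C" "b \<in> Ob C" "f \<in> Mor C a b" "g \<in> closed_class C Inn m a b f"
  shows "closed_class C Inn m a b g = closed_class C Inn m a b f"
  using assms closed_class_mono closed_class_sym closed_class_subset by (meson equalityI subsetD)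

section \<open>Approximate intertwining and the lifting of isomorphisms\<close>

lemma inn_class_isometry:
  assumes abc: "a \<in> Ob C" "b \<in> Ob C" "c \<in> Ob C" and f: "f \<in> Mor C b c"
    and u: "u \<in> inn_class C Inn b c f" and xy: "x \<in> Mor C a b" "y \<in> Mor C a b"
  shows "mdist (m a c) (Cmp C a b c u x) (Cmp C a b c u y) =
    mdist (m a c) (Cmp C a b c f x) (Cmp C a b c f y)"
proof -
  obtain k where k: "k \<in> Inn c" "u = Cmp C b c c k f"
    using u abc f by (auto simp: inn_class_eq)
  then have "Cmp C a b c u x = Cmp C a c c k (Cmp C a b c f x)"
    and "Cmp C a b c u y = Cmp C a c c k (Cmp C a b c f y)"
    using abc f xy by (simp_all add: cmp_assoc inn_mor)
  then show ?thesis
    using inn_isometry abc f xy k by (simp add: cmp_closed)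
qed

text \<open>The last estimate concerns the fixed \<open>f\<close>; by \<open>inn_class_isometry\<close> it is the same
  estimate for any later correction of \<open>f\<close>.\<close>

lemma half_step:
  assumes ab: "a \<in> Ob C" "b \<in> Ob C" and f: "f \<in> Mor C a b" and g: "g \<in> Mor C b a"
    and gf: "closed_class C Inn m a a (Cmp C a b a g f) = closed_class C Inn m a a (Idn C a)"
    and u: "u \<in> inn_class C Inn a b f" and v: "v \<in> Mor C b a" and e: "\<epsilon> > 0"
  obtains v' where "v' \<in> inn_class C Inn b a g"
    "mdist (m a a) (Cmp C a b a v' u) (Idn C a) < \<epsilon>"
    "mdist (m b a) (Cmp C b a a (Cmp C a b a v' u) v) v < \<epsilon>"
    "mdist (m a b) (Cmp C a a b f (Cmp C a b a v' u)) f < \<epsilon>"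
proof -
  have um: "u \<in> Mor C a b" using u inn_class_subset by blast
  note idn = idn_closed[OF ab(1)]
  have "Cmp C a b a g u \<in> inn_class C Inn a a (Cmp C a b a g f)"
    using inn_class_cmp[OF ab(1,2,1) f g u] inn_class_self ab g by blast
  then have "Cmp C a b a g u \<in> closed_class C Inn m a a (Cmp C a b a g f)"
    using inn_class_subset_closed_class ab by blast
  then have "Cmp C a b a g u \<in> closed_class C Inn m a a (Idn C a)"
    by (simp add: gf)
  \<comment> \<open>Symmetry turns the membership around: the identity is now a limit of inner
    corrections of \<open>g \<circ> u\<close>, and these can be moved into \<open>g\<close>.\<close>
  then have "Idn C a \<in> closed_class C Inn m a a (Cmp C a b a g u)"
    using closed_class_sym ab idn by blast
  then obtain \<sigma> where \<sigma>: "\<And>n. \<sigma> n \<in> inn_class C Inn a a (Cmp C a b a g u)"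
    and lim: "limitin (mtopology_of (m a a)) \<sigma> (Idn C a) sequentially"
    using closure_of_sequence unfolding closed_class_def by metis
  \<comment> \<open>Continuity of composition carries the convergence to the identity over to
    composites with \<open>v\<close> and \<open>f\<close>, so one large index satisfies all three
    estimates.\<close>
  have lim2: "limitin (mtopology_of (m b a)) (\<lambda>n. Cmp C b a a (\<sigma> n) v) v sequentially"
    using limitin_cmp[OF ab(2,1,1) limitin_const_mor[OF ab(2,1) v] lim] ab v
    by (simp add: cmp_idn_left)
  have lim3: "limitin (mtopology_of (m a b)) (\<lambda>n. Cmp C a a b f (\<sigma> n)) f sequentially"
    using limitin_cmp[OF ab(1,1,2) lim limitin_const_mor[OF ab f]] ab f
    by (simp add: cmp_idn_right)
  have close: "\<forall>\<^sub>F n in sequentially. mdist M (\<tau> n) x < \<epsilon>"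
    if "limitin (mtopology_of M) \<tau> x sequentially" for M :: "'b metric" and \<tau> x
    using that e Metric_space.limitin_metric[OF Metric_space_mspace_mdist, of M \<tau> x sequentially]
    by (auto simp: mtopology_of_def elim: eventually_mono)
  have "\<forall>\<^sub>F n in sequentially. mdist (m a a) (\<sigma> n) (Idn C a) < \<epsilon> \<and>
      mdist (m b a) (Cmp C b a a (\<sigma> n) v) v < \<epsilon> \<and> mdist (m a b) (Cmp C a a b f (\<sigma> n)) f < \<epsilon>"
    by (intro eventually_conj close lim lim2 lim3)
  then obtain n where n: "mdist (m a a) (\<sigma> n) (Idn C a) < \<epsilon>"
      "mdist (m b a) (Cmp C b a a (\<sigma> n) v) v < \<epsilon>" "mdist (m a b) (Cmp C a a b f (\<sigma> n)) f < \<epsilon>"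
    by (auto simp: eventually_sequentially)
  obtain v' where "v' \<in> inn_class C Inn b a g" "\<sigma> n = Cmp C a b a v' u"
    using inn_class_cmp_left[OF ab(1,2,1) um g \<sigma>[of n]] .
  with n that show ?thesis by simp
qed

text \<open>The morphism \<open>u' \<circ> v \<circ> u\<close> is compared with both ends. Bracketed
  as \<open>u' \<circ> (v \<circ> u)\<close> it is near \<open>u'\<close>, because the estimate
  assumed for \<open>f\<close> transfers to its correction \<open>u'\<close>; bracketed as
  \<open>(u' \<circ> v) \<circ> u\<close> it is near \<open>u\<close>.\<close>

lemma step_dist:
  assumes ab: "a \<in> Ob C" "b \<in> Ob C" and f: "f \<in> Mor C a b"
    and u: "u \<in> inn_class C Inn a b f" and u': "u' \<in> inn_class C Inn a b f" and v: "v \<in> Mor C b a"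
    and 1: "mdist (m a b) (Cmp C a a b f (Cmp C a b a v u)) f < \<epsilon>"
    and 2: "mdist (m a b) (Cmp C a b b (Cmp C b a b u' v) u) u < \<epsilon>"
  shows "mdist (m a b) u u' \<le> 2 * \<epsilon>"
proof -
  have um: "u \<in> Mor C a b" "u' \<in> Mor C a b" using u u' inn_class_subset by blast+
  let ?w = "Cmp C a a b u' (Cmp C a b a v u)"
  have w: "?w \<in> Mor C a b" using ab um v by (simp add: cmp_closed)
  have "mdist (m a b) ?w u' = mdist (m a b) (Cmp C a a b f (Cmp C a b a v u)) f"
    using inn_class_isometry[OF ab(1,1,2) f u', of "Cmp C a b a v u" "Idn C a"] ab f um v
    by (simp add: cmp_closed idn_closed cmp_idn_right)
  moreover have "?w = Cmp C a b b (Cmp C b a b u' v) u"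
    using ab um v by (simp add: cmp_assoc)
  ultimately show ?thesis
    using 1 2 mdist_triangle[of u "m a b" ?w u'] ab um w by (simp add: mspace_mor mdist_commute)
qed

text \<open>The corrections are chosen in the order \<open>u 0\<close>, \<open>v 0\<close>,
  \<open>u 1\<close>, \<open>v 1\<close> and so on, each making its composite with the preceding one
  nearly an identity. This is why \<open>v n\<close> is paired with \<open>u n\<close> on one side
  and with \<open>u (Suc n)\<close> on the other.\<close>

lemma intertwining:
  assumes ab: "a \<in> Ob C" "b \<in> Ob C" and f: "f \<in> Mor C a b" and g: "g \<in> Mor C b a"
    and gf: "closed_class C Inn m a a (Cmp C a b a g f) = closed_class C Inn m a a (Idn C a)"
    and fg: "closed_class C Inn m b b (Cmp C b a b f g) = closed_class C Inn m b b (Idn C b)"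
  obtains u v where "\<And>n. u n \<in> inn_class C Inn a b f" "\<And>n. v n \<in> inn_class C Inn b a g"
    "\<And>n. mdist (m a b) (u n) (u (Suc n)) \<le> 2 * (1/2) ^ n"
    "\<And>n. mdist (m b a) (v n) (v (Suc n)) \<le> 2 * (1/2) ^ n"
    "\<And>n. mdist (m a a) (Cmp C a b a (v n) (u n)) (Idn C a) < (1/2) ^ n"
    "\<And>n. mdist (m b b) (Cmp C b a b (u (Suc n)) (v n)) (Idn C b) < (1/2) ^ n"
proof -
  \<comment> \<open>\<open>P\<close> is the invariant of a single pair. Its last clause mentions the
    original \<open>f\<close>, since the next correction of \<open>f\<close> is not yet known; it
    later bounds the distance from \<open>u n\<close> to \<open>u (Suc n)\<close>.\<close>
  define P where "P n p \<longleftrightarrow> (case p of (u, v) \<Rightarrow>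
      u \<in> inn_class C Inn a b f \<and> v \<in> inn_class C Inn b a g \<and>
      mdist (m a a) (Cmp C a b a v u) (Idn C a) < (1/2) ^ n \<and>
      mdist (m a b) (Cmp C a a b f (Cmp C a b a v u)) f < (1/2) ^ n)" for n :: nat and p
  \<comment> \<open>\<open>Q\<close> holds the estimates that link consecutive pairs, as dependent
    choice requires.\<close>
  define Q where "Q n p p' \<longleftrightarrow> (case p of (u, v) \<Rightarrow> case p' of (u', v') \<Rightarrow>
      mdist (m a b) u u' \<le> 2 * (1/2) ^ n \<and> mdist (m b a) v v' \<le> 2 * (1/2) ^ n \<and>
      mdist (m b b) (Cmp C b a b u' v) (Idn C b) < (1/2) ^ n)" for n :: nat and p p'
  have "\<exists>p. P 0 p"
  proof -
    obtain v where "v \<in> inn_class C Inn b a g"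
      "mdist (m a a) (Cmp C a b a v f) (Idn C a) < 1"
      "mdist (m a b) (Cmp C a a b f (Cmp C a b a v f)) f < 1"
      \<comment> \<open>The construction starts at \<open>u = f\<close> with tolerance
        \<open>1 = (1/2) ^ 0\<close>. There is no earlier \<open>v\<close> to stay close to, so
        \<open>g\<close> fills its place and the resulting estimate is dropped.\<close>
      using half_step[OF ab f g gf inn_class_self[OF ab f] g zero_less_one] .
    then show ?thesis
      using inn_class_self[OF ab f] by (auto simp: P_def)
  qed
  moreover have "\<exists>p'. P (Suc n) p' \<and> Q n p p'" if "P n p" for n p
  proof -
    obtain u v where p: "p = (u, v)" by fastforce
    with that have u: "u \<in> inn_class C Inn a b f" and v: "v \<in> inn_class C Inn b a g"
      and vu: "mdist (m a b) (Cmp C a a b f (Cmp C a b a v u)) f < (1/2) ^ n"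
      by (auto simp: P_def)
    have um: "u \<in> Mor C a b" and vm: "v \<in> Mor C b a"
      using u v inn_class_subset by blast+
    have pos: "(1/2::real) ^ n > 0" "(1/2::real) ^ Suc n > 0" by simp_all
    obtain u' where u': "u' \<in> inn_class C Inn a b f"
      "mdist (m b b) (Cmp C b a b u' v) (Idn C b) < (1/2) ^ n"
      "mdist (m a b) (Cmp C a b b (Cmp C b a b u' v) u) u < (1/2) ^ n"
      "mdist (m b a) (Cmp C b b a g (Cmp C b a b u' v)) g < (1/2) ^ n"
      \<comment> \<open>Here the roles of \<open>a\<close> and \<open>b\<close>, and of
        \<open>f\<close> and \<open>g\<close>, are exchanged: \<open>f\<close> is corrected against
        the current \<open>v\<close>.\<close>
      using half_step[OF ab(2,1) g f fg v um pos(1)] .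
    obtain v' where v': "v' \<in> inn_class C Inn b a g"
      "mdist (m a a) (Cmp C a b a v' u') (Idn C a) < (1/2) ^ Suc n"
      "mdist (m b a) (Cmp C b a a (Cmp C a b a v' u') v) v < (1/2) ^ Suc n"
      "mdist (m a b) (Cmp C a a b f (Cmp C a b a v' u')) f < (1/2) ^ Suc n"
      using half_step[OF ab f g gf u'(1) vm pos(2)] .
    have u'm: "u' \<in> Mor C a b" using u' inn_class_subset by blast
    \<comment> \<open>\<open>step_dist\<close> takes one tolerance for both of its estimates. The
      one from choosing \<open>u'\<close> has \<open>(1/2) ^ n\<close>, so the finer one from
      choosing \<open>v'\<close> is relaxed to match.\<close>
    have "(1/2::real) ^ Suc n \<le> (1/2) ^ n" by simp
    then have "mdist (m b a) (Cmp C b a a (Cmp C a b a v' u') v) v < (1/2) ^ n"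
      using v'(3) by linarith
    then have "mdist (m b a) v v' \<le> 2 * (1/2) ^ n"
      using step_dist[OF ab(2,1) g v v'(1) u'm u'(4)] by blast
    moreover have "mdist (m a b) u u' \<le> 2 * (1/2) ^ n"
      using step_dist[OF ab f u u'(1) vm vu u'(3)] .
    ultimately have "P (Suc n) (u', v') \<and> Q n p (u', v')"
      using u' v' by (simp add: P_def Q_def p)
    then show ?thesis by blast
  qed
  ultimately obtain F where F: "\<And>n. P n (F n) \<and> Q n (F n) (F (Suc n))"
    using dependent_nat_choice[of P Q] by metis
  show ?thesis
    using F by (intro that[of "fst \<circ> F" "snd \<circ> F"]) (auto simp: P_def Q_def split_beta)
qed

lemma limit_Idn:
  assumes a: "a \<in> Ob C" and x: "limitin (mtopology_of (m a a)) \<sigma> x sequentially"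
    and mem: "\<And>n. \<sigma> n \<in> Mor C a a" and d: "\<And>n. mdist (m a a) (\<sigma> n) (Idn C a) < (1/2) ^ n"
  shows "x = Idn C a"
proof -
  interpret Metric_space "mspace (m a a)" "mdist (m a a)" by simp
  have "(\<lambda>n. mdist (m a a) (\<sigma> n) (Idn C a)) \<longlonglongrightarrow> 0"
    by (rule tendsto_sandwich[OF _ _ tendsto_const LIMSEQ_power_zero[of "1/2"]])
      (use d in \<open>auto intro!: always_eventually less_imp_le\<close>)
  then have "limitin mtopology \<sigma> (Idn C a) sequentially"
    unfolding limitin_metric_dist_null using a mem by (simp add: mspace_mor idn_closed)
  then show ?thesis
    using x limitin_metric_unique unfolding mtopology_of_def by (metis sequentially_bot)
qed

text \<open>By completeness the intertwining sequences converge, and by (A1) their composites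
  converge to the composites of the limits, which must be the identities. The limit of the
  corrections of \<open>f\<close> lies in the closed class of \<open>f\<close> and hence has the
  same closed class.\<close>

lemma lift_iso:
  assumes ab: "a \<in> Ob C" "b \<in> Ob C" and f: "f \<in> Mor C a b" and g: "g \<in> Mor C b a"
    and gf: "closed_class C Inn m a a (Cmp C a b a g f) = closed_class C Inn m a a (Idn C a)"
    and fg: "closed_class C Inn m b b (Cmp C b a b f g) = closed_class C Inn m b b (Idn C b)"
  shows "\<exists>\<phi>. is_iso C a b \<phi> \<and> closed_class C Inn m a b \<phi> = closed_class C Inn m a b f"
proof -
  obtain u v where u: "\<And>n. u n \<in> inn_class C Inn a b f" and v: "\<And>n. v n \<in> inn_class C Inn b a g"
    and du: "\<And>n. mdist (m a b) (u n) (u (Suc n)) \<le> 2 * (1/2) ^ n"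
    and dv: "\<And>n. mdist (m b a) (v n) (v (Suc n)) \<le> 2 * (1/2) ^ n"
    and vu: "\<And>n. mdist (m a a) (Cmp C a b a (v n) (u n)) (Idn C a) < (1/2) ^ n"
    and uv: "\<And>n. mdist (m b b) (Cmp C b a b (u (Suc n)) (v n)) (Idn C b) < (1/2) ^ n"
    by (rule intertwining[OF assms]) blast
  have um: "u n \<in> Mor C a b" and vm: "v n \<in> Mor C b a" for n
    using u v inn_class_subset by blast+
  obtain \<phi> where \<phi>: "limitin (mtopology_of (m a b)) u \<phi> sequentially"
    using geometric_imp_convergent[OF complete_mor[OF ab] _ du] um ab by (auto simp: mspace_mor)
  obtain \<gamma> where \<gamma>: "limitin (mtopology_of (m b a)) v \<gamma> sequentially"
    using geometric_imp_convergent[OF complete_mor[OF ab(2,1)] _ dv] vm ab by (auto simp: mspace_mor)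
  \<comment> \<open>The second family of estimates composes \<open>v n\<close> with
    \<open>u (Suc n)\<close>, so the shifted sequence is needed.\<close>
  have \<phi>': "limitin (mtopology_of (m a b)) (\<lambda>n. u (Suc n)) \<phi> sequentially"
    using limitin_sequentially_offset[OF \<phi>, of 1] by simp
  have "Cmp C a b a \<gamma> \<phi> = Idn C a"
    using limit_Idn[OF ab(1) limitin_cmp[OF ab(1,2,1) \<phi> \<gamma>]] vu um vm ab by (simp add: cmp_closed)
  moreover have "Cmp C b a b \<phi> \<gamma> = Idn C b"
    using limit_Idn[OF ab(2) limitin_cmp[OF ab(2,1,2) \<gamma> \<phi>']] uv um vm ab by (simp add: cmp_closed)
  ultimately have "is_iso C a b \<phi>"
    using limitin_mor[OF ab \<phi>] limitin_mor[OF ab(2,1) \<gamma>] by (auto simp: is_iso_def)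
  moreover have "\<phi> \<in> closed_class C Inn m a b f"
    unfolding closed_class_def using \<phi> u by (rule limitin_imp_in_closure_of)
  ultimately show ?thesis
    using closed_class_eq ab f by blast
qed

lemma strong_classification: "strong_classification_functor C (Cout C Inn m) (\<lambda>a. a) (closed_class C Inn m)"
proof -
  interpret F: functor_between C "Cout C Inn m" "\<lambda>a. a" "closed_class C Inn m"
    by (rule functor_Cout)
  show ?thesis
  proof
    fix a b \<psi>
    assume ab: "a \<in> Ob C" "b \<in> Ob C" and "is_iso (Cout C Inn m) a b \<psi>"
    then obtain f g where "f \<in> Mor C a b" "\<psi> = closed_class C Inn m a b f" "g \<in> Mor C b a"
      "Cmp (Cout C Inn m) a b a (closed_class C Inn m b a g) \<psi> = Idn (Cout C Inn m) a"
      "Cmp (Cout C Inn m) b a b \<psi> (closed_class C Inn m b a g) = Idn (Cout C Inn m) b"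
      by (auto simp: is_iso_def Mor_Cout)
    \<comment> \<open>Rewriting with \<open>closed_class_cmp\<close> turns the two inverse laws for
      classes into the equalities of closed classes that \<open>lift_iso\<close> expects.\<close>
    with ab show "\<exists>\<phi>. is_iso C a b \<phi> \<and> closed_class C Inn m a b \<phi> = \<psi>"
      using lift_iso[of a b f g] by (simp add: closed_class_cmp Idn_Cout)
  qed
qed

end

section \<open>From lifting isomorphisms to distinguishing isomorphism classes, and the assembled
  result\<close>

lemma (in strong_classification_functor) classification: "classification_functor C D Fo Fm"
proof
  fix a b
  assume "a \<in> Ob C" "b \<in> Ob C" "isomorphic D (Fo a) (Fo b)"
  then show "isomorphic C a b"
    unfolding isomorphic_def using iso_lift by metis
qed

theorem theorem3:
  fixes C :: "('o, 'm) cat"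
    and Inn :: "'o \<Rightarrow> 'm set"
    and m :: "'o \<Rightarrow> 'o \<Rightarrow> 'm metric"
  assumes "metric_category_with_inner C Inn m"
  shows
    "(axiom_A1 C m \<longrightarrow>
       (\<forall>a \<in> Ob C. \<forall>b \<in> Ob C. \<forall>c \<in> Ob C.
          \<forall>X \<in> Mor (Cout C Inn m) a b. \<forall>Y \<in> Mor (Cout C Inn m) b c.
            Cmp (Cout C Inn m) a b c Y X \<in> Mor (Cout C Inn m) a c) \<and>
       (\<forall>a \<in> Ob C. \<forall>b \<in> Ob C. \<forall>c \<in> Ob C. \<forall>f \<in> Mor C a b. \<forall>g \<in> Mor C b c.
          Cmp (Cout C Inn m) a b c (closed_class C Inn m b c g) (closed_class C Inn m a b f) =
            closed_class C Inn m a c (Cmp C a b c g f)) \<and>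
       category (Cout C Inn m) \<and>
       functor_between C (Cout C Inn m) (\<lambda>a. a) (closed_class C Inn m)) \<and>
     (axiom_A1 C m \<and> axiom_A2 C Inn m \<longrightarrow>
       classification_functor C (Cout C Inn m) (\<lambda>a. a) (closed_class C Inn m) \<and>
       strong_classification_functor C (Cout C Inn m) (\<lambda>a. a) (closed_class C Inn m))"
proof -
  interpret metric_category_with_inner C Inn m by (rule assms)
  show ?thesis
  proof (intro conjI impI)
    assume A1: "axiom_A1 C m"
    interpret A1_category C Inn m by unfold_locales (rule A1)
    show "\<forall>a \<in> Ob C. \<forall>b \<in> Ob C. \<forall>c \<in> Ob C.
        \<forall>X \<in> Mor (Cout C Inn m) a b. \<forall>Y \<in> Mor (Cout C Inn m) b c.
          Cmp (Cout C Inn m) a b c Y X \<in> Mor (Cout C Inn m) a c"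
      by (simp add: Ob_Cout category.cmp_closed[OF category_Cout])
    show "\<forall>a \<in> Ob C. \<forall>b \<in> Ob C. \<forall>c \<in> Ob C. \<forall>f \<in> Mor C a b. \<forall>g \<in> Mor C b c.
        Cmp (Cout C Inn m) a b c (closed_class C Inn m b c g) (closed_class C Inn m a b f) =
          closed_class C Inn m a c (Cmp C a b c g f)"
      by (simp add: closed_class_cmp)
    show "category (Cout C Inn m)" by (rule category_Cout)
    show "functor_between C (Cout C Inn m) (\<lambda>a. a) (closed_class C Inn m)" by (rule functor_Cout)
  next
    assume A: "axiom_A1 C m \<and> axiom_A2 C Inn m"
    interpret A1_A2_category C Inn m by unfold_locales (use A in auto)
    show "strong_classification_functor C (Cout C Inn m) (\<lambda>a. a) (closed_class C Inn m)"
      by (rule strong_classification)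
    then show "classification_functor C (Cout C Inn m) (\<lambda>a. a) (closed_class C Inn m)"
      by (rule strong_classification_functor.classification)
  qed
qed

end
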